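(* Let $N\ge2$ be an integer and let $1<p<p_{JL}$. Then there exists $\nu\in(0,1)$ satisfying $$4\nu(1-\nu)p>1,\qquad\frac{p_S+1}{2\nu}>\frac N2(p-1).$$
   Context: $p_S:=\infty$ if $N=2$ and $p_S:=\frac{N+2}{N-2}$ if $N\ge3$ (when $N=2$ the second inequality is regarded as satisfied). $p_{JL}:=\infty$ if $N\le10$ and $p_{JL}:=\frac{(N-2)^2-4N+8\sqrt{N-1}}{(N-2)(N-10)}$ if $N\ge11$. *)

theory Defs
  imports "HOL-Analysis.Analysis"
begin

text \<open>The Sobolev and Joseph--Lundgren exponents, as extended reals, for dimensions
  \<open>N \<ge> 2\<close>. The values for \<open>N < 2\<close> are not meaningful.\<close>

definition p_S :: "nat \<Rightarrow> ereal" where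
  "p_S N = (if N = 2 then \<infinity> else ereal ((real N + 2) / (real N - 2)))"

definition p_JL :: "nat \<Rightarrow> ereal" where
  "p_JL N = (if N \<le> 10 then \<infinity>
     else ereal (((real N - 2)\<^sup>2 - 4 * real N + 8 * sqrt (real N - 1)) /
                 ((real N - 2) * (real N - 10))))"

text \<open>Sanity check: extended-real arithmetic realises the convention that an inequality
  \<open>(p_S N + 1) / (2 * \<nu>) > c\<close> counts as satisfied when \<open>N = 2\<close>.\<close>

lemma p_S_two_divide:
  fixes \<nu> c :: real
  assumes "0 < \<nu>"
  shows "(p_S 2 + 1) / ereal (2 * \<nu>) > ereal c"
  using assms by (simp add: p_S_def)

end

theory Submission
  imports Defs
begin

text \<open>
  Put \<open>s = sqrt (1 - 1/p)\<close> and \<open>r = sqrt (N - 1)\<close>. The first inequality means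
  \<open>\<bar>2 * \<nu> - 1\<bar> < s\<close>, and for \<open>N \<ge> 3\<close> the second one is an upper bound on \<open>\<nu>\<close>, namely
  \<open>\<nu> < 2 / ((N - 2) * (p - 1))\<close>. A suitable \<open>\<nu>\<close> exists iff the smallest value allowed by the
  first, \<open>(1 - s) / 2\<close>, is below this bound; since \<open>p - 1 = s\<^sup>2 / (1 - s\<^sup>2)\<close>, this reads
  \<open>(r\<^sup>2 - 1) * s\<^sup>2 < 4 * (1 + s)\<close>, that is, \<open>s * (r - 1) < 2\<close>. For \<open>N \<le> 10\<close> this follows from
  \<open>s < 1\<close> and \<open>r \<le> 3\<close>; for \<open>N \<ge> 11\<close> it is equivalent to \<open>p < p_JL N\<close>, because the exponent
  factors as \<open>p_JL N = (r - 1)\<^sup>2 / ((r - 1)\<^sup>2 - 4)\<close>.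
\<close>

lemma p_JL_eq:
  assumes "N \<ge> 11"
  shows "p_JL N = ereal ((sqrt (real N - 1) - 1)\<^sup>2 / ((sqrt (real N - 1) - 1)\<^sup>2 - 4))"
proof -
  define r where "r = sqrt (real N - 1)"
  have rN: "real N = r\<^sup>2 + 1"
    using assms by (simp add: r_def)
  have "sqrt 9 < r"
    unfolding r_def using assms by (intro real_sqrt_less_mono) simp
  then have r: "r > 3"
    by simp
  \<comment> \<open>As \<open>-4 * N + 8 * r = -4 * (r - 1)\<^sup>2\<close>, the numerator is a
    difference of squares and shares \<open>(r - 1) * (r + 3)\<close> with the denominator.\<close>
  have num: "(real N - 2)\<^sup>2 - 4 * real N + 8 * r = (r - 1)\<^sup>2 * ((r - 1) * (r + 3))"
    unfolding rN by (simp add: algebra_simps power2_eq_square)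
  have den: "(real N - 2) * (real N - 10) = ((r - 1)\<^sup>2 - 4) * ((r - 1) * (r + 3))"
    unfolding rN by (simp add: algebra_simps power2_eq_square)
  have "(r - 1) * (r + 3) \<noteq> 0"
    using r by simp
  then show ?thesis
    using assms by (simp add: p_JL_def num den flip: r_def)
qed

lemma less_p_JL_imp:
  fixes p :: real
  assumes "N \<ge> 3" and "1 < p" and "ereal p < p_JL N"
  shows "sqrt (1 - 1 / p) * (sqrt (real N - 1) - 1) < 2"
proof -
  define s where "s = sqrt (1 - 1 / p)"
  define r where "r = sqrt (real N - 1)"
  have s: "0 < s" "s < 1" and s2: "s\<^sup>2 = 1 - 1 / p"
    using \<open>1 < p\<close> by (auto simp: s_def)
  have "s * (r - 1) < 2"
  proof (cases "N \<le> 10")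
    case True
    then have "r \<le> sqrt 9"
      unfolding r_def by (intro real_sqrt_le_mono) simp
    then have "s * (r - 1) \<le> s * 2"
      using s by (intro mult_left_mono) simp_all
    then show ?thesis
      using s by linarith
  next
    case False
    define t where "t = (r - 1)\<^sup>2"
    \<comment> \<open>This makes \<open>t - 4\<close> positive, so clearing the denominator keeps
      the inequality.\<close>
    have "sqrt 9 < r"
      unfolding r_def using False by (intro real_sqrt_less_mono) simp
    then have r: "r > 3"
      by simp
    then have "2\<^sup>2 < (r - 1)\<^sup>2"
      by (intro power_strict_mono) simp_all
    then have t: "t > 4"
      by (simp add: t_def)
    have "p < t / (t - 4)"
      using False assms(3) by (simp add: p_JL_eq t_def r_def)
    then have "p * (t - 4) < t"
      using t by (simp add: pos_less_divide_eq)
    then have "(1 - 1 / p) * t < 4"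
      using \<open>1 < p\<close> by (simp add: field_simps)
    then have "(s * (r - 1))\<^sup>2 < 2\<^sup>2"
      by (simp add: power_mult_distrib s2 t_def)
    then show ?thesis
      by (rule power2_less_imp_less) simp
  qed
  then show ?thesis
    by (simp add: s_def r_def)
qed

text \<open>Since \<open>p_S N + 1 = 2 * N / (N - 2)\<close>, the factor \<open>N / 2\<close>
  cancels.\<close>

lemma p_S_divide_greater_iff:
  fixes \<nu> p :: real
  assumes "N \<ge> 3" and "0 < \<nu>" and "1 < p"
  shows "(p_S N + 1) / ereal (2 * \<nu>) > ereal (real N / 2 * (p - 1)) \<longleftrightarrow>
    \<nu> < 2 / ((real N - 2) * (p - 1))"
proof -
  define m where "m = real N - 2"
  define q where "q = p - 1"
  have pos: "m > 0" "q > 0" "real N / 2 > 0"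
    using assms by (simp_all add: m_def q_def)
  have "(real N + 2) / m + 1 = 2 * real N / m"
    using pos by (simp add: m_def field_simps)
  then have "(p_S N + 1) / ereal (2 * \<nu>) = ereal (real N / 2 * (2 / (m * \<nu>)))"
    using assms by (simp add: p_S_def one_ereal_def m_def)
  moreover have "real N / 2 * q < real N / 2 * (2 / (m * \<nu>)) \<longleftrightarrow> q < 2 / (m * \<nu>)"
    using pos(3) by (rule mult_less_cancel_left_pos)
  moreover have "\<dots> \<longleftrightarrow> \<nu> < 2 / (m * q)"
    using pos \<open>0 < \<nu>\<close> by (simp add: field_simps)
  ultimately show ?thesis
    by (simp only: m_def q_def less_ereal.simps)
qed

theorem lemma5p5:
  fixes N :: nat and p :: real
  assumes "N \<ge> 2" and "1 < p" and "ereal p < p_JL N"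
  shows "\<exists>\<nu>\<in>{0<..<1::real}. 4 * \<nu> * (1 - \<nu>) * p > 1 \<and>
           (p_S N + 1) / ereal (2 * \<nu>) > ereal (real N / 2 * (p - 1))"
proof (cases "N = 2")
  case True
  \<comment> \<open>Only the first inequality constrains \<open>\<nu>\<close>; \<open>1/2\<close>
    maximises \<open>\<nu> * (1 - \<nu>)\<close> and reduces it to \<open>p > 1\<close>.\<close>
  then show ?thesis
    using \<open>1 < p\<close> p_S_two_divide[of "1/2"] by (intro bexI[of _ "1/2"]) auto
next
  case False
  then have N: "N \<ge> 3"
    using assms by simp
  define s where "s = sqrt (1 - 1 / p)"
  define r where "r = sqrt (real N - 1)"
  have s: "0 < s" "s < 1" and s2: "s\<^sup>2 = 1 - 1 / p"
    using \<open>1 < p\<close> by (auto simp: s_def)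
  have rN: "real N = r\<^sup>2 + 1"
    using N by (simp add: r_def)
  have r: "r > 1"
    using N by (simp add: r_def)
  have sr: "s * (r - 1) < 2"
    using less_p_JL_imp[OF N assms(2,3)] by (simp add: s_def r_def)
  \<comment> \<open>The second factor is \<open>s * (r + 1)\<close>, so the left side is
    \<open>s\<^sup>2 * (r\<^sup>2 - 1)\<close>.\<close>
  have "(s * (r - 1)) * (s * (r - 1) + 2 * s) < 2 * (2 + 2 * s)"
    using sr s r by (intro mult_strict_mono) auto
  then have key: "(real N - 2) * s\<^sup>2 < 4 * (1 + s)"
    unfolding rN by (simp add: algebra_simps power2_eq_square)
  have "p * s\<^sup>2 = p - 1"
    using \<open>1 < p\<close> by (simp add: s2 field_simps)
  then have ps: "p * (1 - s) * (1 + s) = 1" "p - 1 = p * s\<^sup>2"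
    by (simp_all add: algebra_simps power2_eq_square)
  have "(1 - s) * ((real N - 2) * (p - 1)) = p * (1 - s) * ((real N - 2) * s\<^sup>2)"
    unfolding ps(2) by (simp add: algebra_simps)
  also have "\<dots> < p * (1 - s) * (4 * (1 + s))"
    using key s \<open>1 < p\<close> by (intro mult_strict_left_mono) auto
  also have "\<dots> = 4"
    using ps(1) by (simp add: algebra_simps)
  finally have "(1 - s) / 2 < 2 / ((real N - 2) * (p - 1))"
    using N \<open>1 < p\<close> by (simp add: pos_less_divide_eq)
  \<comment> \<open>The bound \<open>(1 + s) / 2\<close> keeps \<open>\<nu>\<close> below the larger
    root of \<open>4 * \<nu> * (1 - \<nu>) * p = 1\<close>.\<close>
  then have "(1 - s) / 2 < min (2 / ((real N - 2) * (p - 1))) ((1 + s) / 2)"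
    using s by simp
  from dense[OF this] obtain \<nu> where \<nu>: "(1 - s) / 2 < \<nu>"
      "\<nu> < 2 / ((real N - 2) * (p - 1))" "\<nu> < (1 + s) / 2"
    by auto
  have \<nu>01: "0 < \<nu>" "\<nu> < 1"
    using \<nu> s by auto
  have "\<bar>2 * \<nu> - 1\<bar> < s"
    using \<nu> by (simp add: abs_less_iff)
  then have "(2 * \<nu> - 1)\<^sup>2 < s\<^sup>2"
    using power_strict_mono[of "\<bar>2 * \<nu> - 1\<bar>" s 2] by simp
  \<comment> \<open>Uses
    \<open>4 * \<nu> * (1 - \<nu>) = 1 - (2 * \<nu> - 1)\<^sup>2\<close>.\<close>
  then have "1 / p < 4 * \<nu> * (1 - \<nu>)"
    unfolding s2 by (simp add: algebra_simps power2_eq_square)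
  then have "4 * \<nu> * (1 - \<nu>) * p > 1"
    using \<open>1 < p\<close> by (simp add: pos_divide_less_eq)
  moreover have "(p_S N + 1) / ereal (2 * \<nu>) > ereal (real N / 2 * (p - 1))"
    using p_S_divide_greater_iff[OF N \<nu>01(1) \<open>1 < p\<close>] \<nu>(2) by simp
  ultimately show ?thesis
    using \<nu>01 by auto
qed

end
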